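(* For every integer $r\ge 2$, the set $S_{\mathrm{non}}^{(r)}=[0,1]^r\setminus S_{\mathrm{rep}}^{(r)}$ is convex.
   Context: Fix an integer $r\ge2$ and write $[r]=\{1,\dots,r\}$. A generator is a vector $(a_{ij})_{i\neq j\in[r]}$ with $r(r-1)$ coordinates such that $0\le a_{ij}\le 1$ and $a_{ij}+a_{ji}\le 1$ for all $i\neq j$. It generates the tuple $(a_1,\dots,a_r)$ with $a_i=\prod_{j\in[r]\setminus\{i\}}a_{ij}$. A tuple in $\mathbb R^r_{\ge0}$ is representable if some generator generates it; $S_{\mathrm{rep}}^{(r)}$ denotes the set of representable tuples. *)

theory Defs
  imports "HOL-Analysis.Analysis"
begin

text \<open>The index set \<open>[r]\<close> is a finite type \<open>'r\<close> with \<open>CARD('r) = r\<close>. A generator has no diagonal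
  coordinates; here the diagonal entries of the function \<open>a\<close> exist but are neither constrained
  nor used.\<close>

definition generator :: "('r::finite \<Rightarrow> 'r \<Rightarrow> real) \<Rightarrow> bool" where
  "generator a \<longleftrightarrow>
     (\<forall>i j. i \<noteq> j \<longrightarrow> 0 \<le> a i j \<and> a i j \<le> 1 \<and> a i j + a j i \<le> 1)"

definition generated_tuple :: "('r::finite \<Rightarrow> 'r \<Rightarrow> real) \<Rightarrow> real ^ 'r" where
  "generated_tuple a = (\<chi> i. \<Prod>j\<in>UNIV - {i}. a i j)"

definition representable :: "real ^ 'r::finite \<Rightarrow> bool" where
  "representable x \<longleftrightarrow>
     (\<forall>i. 0 \<le> x $ i) \<and> (\<exists>a. generator a \<and> generated_tuple a = x)"

definition S_rep :: "(real ^ 'r::finite) set" where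
  "S_rep = {x. representable x}"

definition S_non :: "(real ^ 'r::finite) set" where
  "S_non = {x. \<forall>i. 0 \<le> x $ i \<and> x $ i \<le> 1} - S_rep"

end

theory Submission
  imports Defs "HOL-Real_Asymp.Real_Asymp"
begin

text \<open>For positive weights \<open>l\<close> let \<open>f\<^sub>i(l) = \<Prod>j\<noteq>i. l\<^sub>i / (l\<^sub>i + l\<^sub>j)\<close>. By Gibbs' inequality on each pair, the
  generator \<open>l\<^sub>i / (l\<^sub>i + l\<^sub>j)\<close> maximises \<open>\<Sum>i. l\<^sub>i ln a\<^sub>i\<close> among all generated tuples, so \<open>s f(l)\<close> is
  representable iff \<open>s \<le> 1\<close>; and every positive tuple has the form \<open>s f(l)\<close>. The hyperplane
  \<open>\<Sum>i. l\<^sub>i x\<^sub>i / f\<^sub>i(l) = \<Sum>i. l\<^sub>i\<close> supports the set of non-representable tuples at \<open>f(l)\<close>: by \<open>t \<ge> 1 + ln t\<close>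
  with weights \<open>m\<close>, the inequality needed at \<open>f(m)\<close> follows from a comparison of the relative entropy of \<open>m\<close>
  with respect to \<open>l\<close> with the relative entropies on pairs. Evaluating
  this functional at a point \<open>w f(l)\<close> of a segment between non-representable positive tuples gives \<open>w > 1\<close>.\<close>

section \<open>Sums over ordered pairs of distinct indices\<close>

lemma sum_off_diagonal_swap:
  fixes g :: "'r::finite \<Rightarrow> 'r \<Rightarrow> 'a::comm_monoid_add"
  shows "(\<Sum>i\<in>UNIV. \<Sum>j\<in>UNIV - {i}. g i j) = (\<Sum>i\<in>UNIV. \<Sum>j\<in>UNIV - {i}. g j i)"
proof -
  have "(\<Sum>i\<in>UNIV. \<Sum>j\<in>UNIV - {i}. g i j) = (\<Sum>i\<in>UNIV. \<Sum>j\<in>{j\<in>UNIV. i \<noteq> j}. g i j)"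
    by (intro sum.cong refl) auto
  also have "\<dots> = (\<Sum>j\<in>UNIV. \<Sum>i\<in>{i\<in>UNIV. i \<noteq> j}. g i j)"
    by (rule sum.swap_restrict) auto
  also have "\<dots> = (\<Sum>i\<in>UNIV. \<Sum>j\<in>UNIV - {i}. g j i)"
    by (intro sum.cong refl) auto
  finally show ?thesis .
qed

text \<open>Adding the sum to its transpose doubles it, so it suffices to compare both orders of a
  pair together. The entropy estimates below generally hold only in this combined form.\<close>

lemma sum_off_diagonal_mono:
  fixes g h :: "'r::finite \<Rightarrow> 'r \<Rightarrow> real"
  assumes "\<And>i j. i \<noteq> j \<Longrightarrow> g i j + g j i \<le> h i j + h j i"
  shows "(\<Sum>i\<in>UNIV. \<Sum>j\<in>UNIV - {i}. g i j) \<le> (\<Sum>i\<in>UNIV. \<Sum>j\<in>UNIV - {i}. h i j)"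
proof -
  have sym: "(\<Sum>i\<in>UNIV. \<Sum>j\<in>UNIV - {i}. k i j + k j i)
      = 2 * (\<Sum>i\<in>UNIV. \<Sum>j\<in>UNIV - {i}. k i j)" for k :: "'r \<Rightarrow> 'r \<Rightarrow> real"
    using sum_off_diagonal_swap[of k] by (simp add: sum.distrib)
  have "(\<Sum>i\<in>UNIV. \<Sum>j\<in>UNIV - {i}. g i j + g j i) \<le> (\<Sum>i\<in>UNIV. \<Sum>j\<in>UNIV - {i}. h i j + h j i)"
    by (intro sum_mono) (use assms in auto)
  then show ?thesis
    unfolding sym by simp
qed

lemma sum_off_diagonal_cong:
  fixes g h :: "'r::finite \<Rightarrow> 'r \<Rightarrow> real"
  assumes "\<And>i j. i \<noteq> j \<Longrightarrow> g i j + g j i = h i j + h j i"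
  shows "(\<Sum>i\<in>UNIV. \<Sum>j\<in>UNIV - {i}. g i j) = (\<Sum>i\<in>UNIV. \<Sum>j\<in>UNIV - {i}. h i j)"
  using sum_off_diagonal_mono[of g h] sum_off_diagonal_mono[of h g] assms
  by (simp add: order_antisym)

section \<open>Share tuples and the pairwise Gibbs inequality\<close>

definition share_tuple :: "real ^ 'r::finite \<Rightarrow> real ^ 'r" where
  "share_tuple l = generated_tuple (\<lambda>i j. l $ i / (l $ i + l $ j))"

text \<open>This form of \<open>\<Sum>i. l\<^sub>i ln (share_tuple l)\<^sub>i\<close> stays continuous on \<open>l \<ge> 0\<close> (note \<open>ln 0 = 0\<close>).\<close>

definition share_entropy :: "real ^ 'r::finite \<Rightarrow> real" where
  "share_entropy l = (\<Sum>i\<in>UNIV. \<Sum>j\<in>UNIV - {i}.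
     l $ i * ln (l $ i) - (l $ i + l $ j) * ln (l $ i + l $ j) / 2)"

lemma generator_share:
  assumes "\<And>i. 0 < l $ i"
  shows "generator (\<lambda>i j. l $ i / (l $ i + l $ j))"
  unfolding generator_def
proof (intro allI impI conjI)
  fix i j
  have "0 < l $ i" "0 < l $ j" using assms by auto
  then show "0 \<le> l $ i / (l $ i + l $ j)" "l $ i / (l $ i + l $ j) \<le> 1"
    "l $ i / (l $ i + l $ j) + l $ j / (l $ j + l $ i) \<le> 1"
    by (auto simp: field_simps)
qed

lemma share_tuple_pos: "(\<And>i. 0 < l $ i) \<Longrightarrow> 0 < share_tuple l $ i"
  unfolding share_tuple_def generated_tuple_def
  by (auto intro!: prod_pos divide_pos_pos add_pos_pos)

lemma ln_generated_tuple:
  assumes "\<And>i j. i \<noteq> j \<Longrightarrow> 0 < a i j"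
  shows "ln (generated_tuple a $ i) = (\<Sum>j\<in>UNIV - {i}. ln (a i j))"
  unfolding generated_tuple_def by (simp, subst ln_prod) (use assms in \<open>auto simp: less_imp_neq[THEN not_sym]\<close>)

lemma ln_share_tuple:
  assumes "\<And>i. 0 < l $ i"
  shows "ln (share_tuple l $ i) = (\<Sum>j\<in>UNIV - {i}. ln (l $ i) - ln (l $ i + l $ j))"
  unfolding share_tuple_def
proof (subst ln_generated_tuple)
  show "0 < l $ i / (l $ i + l $ j)" for i j
    using assms by (auto intro!: divide_pos_pos add_pos_pos)
  have "ln (l $ i / (l $ i + l $ j)) = ln (l $ i) - ln (l $ i + l $ j)" for j
    using assms[of i] assms[of j] by (simp add: ln_div)
  then show "(\<Sum>j\<in>UNIV - {i}. ln (l $ i / (l $ i + l $ j))) = (\<Sum>j\<in>UNIV - {i}. ln (l $ i) - ln (l $ i + l $ j))"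
    by simp
qed

text \<open>The \<open>/ 2\<close> in \<open>share_entropy\<close> splits
  \<open>(l $ i + l $ j) * ln (l $ i + l $ j)\<close> equally between both orders of a pair, so the
  sums agree once the orders are combined.\<close>

lemma share_entropy_eq:
  assumes "\<And>i. 0 < l $ i"
  shows "share_entropy l = (\<Sum>i\<in>UNIV. l $ i * ln (share_tuple l $ i))"
  unfolding share_entropy_def
  by (simp only: ln_share_tuple[OF assms] sum_distrib_left, rule sum_off_diagonal_cong)
    (simp add: algebra_simps add_divide_distrib)

text \<open>Apply \<open>ln t <= t - 1\<close> at \<open>t = a * (l + k) / l\<close> with weight
  \<open>l\<close> and at \<open>t = b * (l + k) / k\<close> with weight \<open>k\<close>; the
  bounds add up to \<open>(a + b) * (l + k) - (l + k)\<close>, which is at most 0. A zero weight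
  leaves only the logarithm of a number at most 1.\<close>

lemma ln_pair_gibbs:
  fixes l k a b :: real
  assumes "0 \<le> l" "0 \<le> k" "0 < a" "0 < b" "a + b \<le> 1"
  shows "l * ln a + k * ln b \<le> l * ln l + k * ln k - (l + k) * ln (l + k)"
proof -
  have edge: "x * ln c \<le> 0" if "0 \<le> x" "0 < c" "c \<le> 1" for x c :: real
    using that by (simp add: mult_nonneg_nonpos)
  have term_le: "x * (ln c - ln x + ln (l + k)) \<le> c * (l + k) - x" if "0 < x" "0 < c" "0 < l + k" for x c
  proof -
    have "ln c - ln x + ln (l + k) = ln (c * (l + k) / x)"
      using that by (simp add: ln_mult ln_div)
    also have "\<dots> \<le> c * (l + k) / x - 1"
      by (rule ln_le_minus_one) (use that in simp)
    finally have "x * (ln c - ln x + ln (l + k)) \<le> x * (c * (l + k) / x - 1)"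
      using that by (intro mult_left_mono) auto
    then show ?thesis using that by (simp add: right_diff_distrib)
  qed
  consider "l = 0" | "k = 0" | "0 < l" "0 < k"
    using assms by linarith
  then show ?thesis
  proof cases
    case 3
    have "(a + b) * (l + k) \<le> l + k"
      using assms by (simp add: mult_left_le_one_le)
    then show ?thesis
      using term_le[of l a] term_le[of k b] 3 assms by (simp add: algebra_simps)
  qed (use edge[of k b] edge[of l a] assms in auto)
qed

text \<open>Logarithms turn the products into sums over ordered pairs, and
  \<open>ln_pair_gibbs\<close> applies to each unordered pair. Zero weights are allowed so that
  boundary points of the simplex are covered.\<close>

lemma gibbs_generated_tuple:
  assumes "generator a" and pos: "\<And>i j. i \<noteq> j \<Longrightarrow> 0 < a i j" and l: "\<And>i. 0 \<le> l $ i"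
  shows "(\<Sum>i\<in>UNIV. l $ i * ln (generated_tuple a $ i)) \<le> share_entropy l"
proof -
  have ln_eq: "ln (generated_tuple a $ i) = (\<Sum>j\<in>UNIV - {i}. ln (a i j))" for i
    by (rule ln_generated_tuple) (rule pos)
  show ?thesis
    unfolding share_entropy_def ln_eq sum_distrib_left
  proof (rule sum_off_diagonal_mono)
    fix i j :: 'a assume "i \<noteq> j"
    then have "l $ i * ln (a i j) + l $ j * ln (a j i)
      \<le> l $ i * ln (l $ i) + l $ j * ln (l $ j) - (l $ i + l $ j) * ln (l $ i + l $ j)"
      using assms by (intro ln_pair_gibbs) (auto simp: generator_def)
    then show "l $ i * ln (a i j) + l $ j * ln (a j i)
      \<le> l $ i * ln (l $ i) - (l $ i + l $ j) * ln (l $ i + l $ j) / 2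
        + (l $ j * ln (l $ j) - (l $ j + l $ i) * ln (l $ j + l $ i) / 2)"
      by (simp add: add.commute)
  qed
qed

lemma gibbs_share_tuple:
  assumes "\<And>i. 0 < m $ i" and "\<And>i. 0 \<le> l $ i"
  shows "(\<Sum>i\<in>UNIV. l $ i * ln (share_tuple m $ i)) \<le> share_entropy l"
  unfolding share_tuple_def
  by (rule gibbs_generated_tuple[OF generator_share])
    (use assms in \<open>auto intro!: divide_pos_pos add_pos_pos\<close>)

section \<open>Representable multiples of share tuples, and downward closure\<close>

text \<open>Gibbs with weights \<open>l\<close> is an equality at \<open>share_tuple l\<close>; the
  factor \<open>s\<close> adds \<open>ln s\<close> times the total weight to the left side, so
  \<open>ln s <= 0\<close>.\<close>

lemma representable_scaled_share_tuple:
  assumes l: "\<And>i. 0 < l $ i" and "0 < s" and rep: "representable (s *\<^sub>R share_tuple l)"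
  shows "s \<le> 1"
proof -
  obtain a where a: "generator a" "generated_tuple a = s *\<^sub>R share_tuple l"
    using rep by (auto simp: representable_def)
  have pos: "0 < a i j" if "i \<noteq> j" for i j
  proof -
    have "0 < generated_tuple a $ i"
      using a(2) share_tuple_pos[of l i] l \<open>0 < s\<close> by simp
    then have "a i j \<noteq> 0"
      using that by (auto simp: generated_tuple_def less_le prod_zero_iff)
    moreover have "0 \<le> a i j" using a(1) that by (auto simp: generator_def)
    ultimately show ?thesis by simp
  qed
  have sum_pos: "0 < (\<Sum>i\<in>UNIV. l $ i)"
    using l by (intro sum_pos) auto
  have "(\<Sum>i\<in>UNIV. l $ i * ln (generated_tuple a $ i)) \<le> (\<Sum>i\<in>UNIV. l $ i * ln (share_tuple l $ i))"
    using gibbs_generated_tuple[of a l] a(1) pos l share_entropy_eq[of l] by (simp add: less_imp_le)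
  moreover have "ln (generated_tuple a $ i) = ln s + ln (share_tuple l $ i)" for i
    using a(2) share_tuple_pos[of l i] l \<open>0 < s\<close> by (simp add: ln_mult)
  ultimately have "(\<Sum>i\<in>UNIV. l $ i) * ln s \<le> 0"
    by (simp add: distrib_left sum.distrib sum_distrib_right)
  then have "ln s \<le> 0"
    using sum_pos by (simp add: mult_le_0_iff)
  then show ?thesis
    using \<open>0 < s\<close> by simp
qed

text \<open>Lowering coordinates keeps a generator a generator, so one coordinate in each row is
  shrunk by the factor \<open>y $ i / x $ i\<close>.\<close>

lemma representable_mono:
  fixes x :: "real ^ 'r::finite"
  assumes "CARD('r) \<ge> 2" "representable x" and y: "\<And>i. 0 \<le> y $ i" "\<And>i. y $ i \<le> x $ i"
  shows "representable y"
proof -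
  obtain a where a: "generator a" "generated_tuple a = x"
    using assms by (auto simp: representable_def)
  \<comment> \<open>Here \<open>r >= 2\<close> enters: each row has an off-diagonal coordinate to
    shrink.\<close>
  have "\<exists>j. j \<noteq> i" for i :: 'r
  proof (rule ccontr)
    assume "\<not> ?thesis"
    then have "(UNIV :: 'r set) = {i}" by auto
    then show False using assms(1) by (metis One_nat_def is_singletonI is_singleton_altdef numeral_le_one_iff semiring_norm(69))
  qed
  then obtain k where k: "\<And>i :: 'r. k i \<noteq> i" by metis
  \<comment> \<open>If \<open>x $ i = 0\<close> then \<open>y $ i = 0\<close> as well, so the
    default factor 0 is correct.\<close>
  define t where "t i = (if x $ i = 0 then 0 else y $ i / x $ i)" for i
  have t: "0 \<le> t i" "t i \<le> 1" "t i * x $ i = y $ i" for i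
    using y[of i] by (auto simp: t_def field_simps)
  define b where "b i j = (if j = k i then t i else 1) * a i j" for i j
  have le: "0 \<le> b i j" "b i j \<le> a i j" if "i \<noteq> j" for i j
    using a(1) t that by (auto simp: b_def generator_def mult_left_le_one_le)
  have "generator b"
    unfolding generator_def
  proof (intro allI impI conjI)
    fix i j :: 'r assume "i \<noteq> j"
    with le[of i j] le[of j i] a(1)
    show "0 \<le> b i j" "b i j \<le> 1" "b i j + b j i \<le> 1"
      unfolding generator_def by (smt (verit))+
  qed
  moreover have "generated_tuple b = y"
  proof (subst vec_eq_iff, intro allI)
    fix i
    have "generated_tuple b $ i = t i * generated_tuple a $ i"
      using k[of i] by (simp add: generated_tuple_def b_def prod.distrib prod.delta)
    then show "generated_tuple b $ i = y $ i"
      using a t by simp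
  qed
  ultimately show ?thesis
    using y by (auto simp: representable_def)
qed

lemma representable_share_tuple:
  assumes "\<And>i. 0 < l $ i"
  shows "representable (share_tuple l)"
  unfolding representable_def
  using generator_share[of l] assms share_tuple_pos[of l] by (auto simp: share_tuple_def less_imp_le)

section \<open>Convexity of the entropy gap and the supporting hyperplane\<close>

text \<open>The gap is \<open>x y (1/(x + y) - 1) (d/x - e/y)^2\<close>.\<close>

lemma pair_hessian_le:
  fixes x y d e :: real
  assumes "0 < x" "0 < y" "x + y \<le> 1"
  shows "y * d^2 / x - d * e + (x * e^2 / y - e * d)
      \<le> d^2 / x - d * (d + e) / (x + y) + (e^2 / y - e * (e + d) / (y + x))"
proof -
  have "d^2 / x + e^2 / y - (d + e)^2 / (x + y) = (d * y - e * x)^2 / (x * y * (x + y))"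
    using assms by (simp add: field_simps) algebra
  moreover have "y * d^2 / x + x * e^2 / y - 2 * d * e = (d * y - e * x)^2 / (x * y)"
    using assms by (simp add: field_simps) algebra
  moreover have "(d * y - e * x)^2 / (x * y) \<le> (d * y - e * x)^2 / (x * y * (x + y))"
    using assms by (intro divide_left_mono) (auto simp: mult_left_le)
  moreover have "d * (d + e) / (x + y) + e * (e + d) / (y + x) = (d + e)^2 / (x + y)"
    by (simp add: add.commute power2_eq_square add_divide_distrib algebra_simps)
  ultimately show ?thesis by (simp add: algebra_simps)
qed

text \<open>Right side minus left side is the second derivative in
  \<open>relative_entropy_le_pairs\<close>. As \<open>x\<close> sums to 1 and \<open>e\<close> to 0,
  the left side spreads over pairs as \<open>x j * (e i)^2 / x i - e i * e j\<close>, and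
  \<open>pair_hessian_le\<close> applies because \<open>x i + x j <= 1\<close>.\<close>

lemma hessian_nonneg:
  fixes x e :: "'r::finite \<Rightarrow> real"
  assumes x: "\<And>i. 0 < x i" "(\<Sum>i\<in>UNIV. x i) = 1" and e: "(\<Sum>i\<in>UNIV. e i) = 0"
  shows "(\<Sum>i\<in>UNIV. (e i)^2 / x i)
    \<le> (\<Sum>i\<in>UNIV. \<Sum>j\<in>UNIV - {i}. (e i)^2 / x i - e i * (e i + e j) / (x i + x j))"
proof -
  have rest: "(\<Sum>j\<in>UNIV - {i}. f j) = (\<Sum>j\<in>UNIV. f j) - f i" for f :: "'r \<Rightarrow> real" and i
    by (simp add: sum_diff1)
  have "(\<Sum>j\<in>UNIV - {i}. x j * (e i)^2 / x i - e i * e j) = (e i)^2 / x i" for i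
  proof -
    have "(\<Sum>j\<in>UNIV. x j * (e i)^2 / x i - e i * e j)
      = (\<Sum>j\<in>UNIV. x j) * (e i)^2 / x i - e i * (\<Sum>j\<in>UNIV. e j)"
      by (simp add: sum_subtractf sum_distrib_left sum_distrib_right sum_divide_distrib)
    then show ?thesis
      unfolding rest using x(1)[of i] by (simp add: x e power2_eq_square less_imp_neq[THEN not_sym])
  qed
  then have "(\<Sum>i\<in>UNIV. (e i)^2 / x i) = (\<Sum>i\<in>UNIV. \<Sum>j\<in>UNIV - {i}. x j * (e i)^2 / x i - e i * e j)"
    by simp
  also have "\<dots> \<le> (\<Sum>i\<in>UNIV. \<Sum>j\<in>UNIV - {i}. (e i)^2 / x i - e i * (e i + e j) / (x i + x j))"
  proof (rule sum_off_diagonal_mono)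
    fix i j :: 'r assume ij: "i \<noteq> j"
    have "x i + x j = (\<Sum>k\<in>{i, j}. x k)" using ij by simp
    also have "\<dots> \<le> (\<Sum>k\<in>UNIV. x k)"
      by (rule sum_mono2) (use x(1) in \<open>auto simp: less_imp_le\<close>)
    finally show "x j * (e i)^2 / x i - e i * e j + (x i * (e j)^2 / x j - e j * e i)
      \<le> (e i)^2 / x i - e i * (e i + e j) / (x i + x j)
        + ((e j)^2 / x j - e j * (e j + e i) / (x j + x i))"
      by (intro pair_hessian_le) (use x in auto)
  qed
  finally show ?thesis .
qed

lemma nonneg_of_second_derivative:
  fixes f f' f'' :: "real \<Rightarrow> real"
  assumes f: "\<And>t. 0 \<le> t \<Longrightarrow> t \<le> 1 \<Longrightarrow> (f has_real_derivative f' t) (at t)"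
    and f': "\<And>t. 0 \<le> t \<Longrightarrow> t \<le> 1 \<Longrightarrow> (f' has_real_derivative f'' t) (at t)"
    and f'': "\<And>t. 0 \<le> t \<Longrightarrow> t \<le> 1 \<Longrightarrow> 0 \<le> f'' t"
    and "f 0 = 0" "f' 0 = 0"
  shows "0 \<le> f 1"
proof -
  have "0 \<le> f' t" if "0 \<le> t" "t \<le> 1" for t
    using DERIV_nonneg_imp_nondecreasing[OF that(1), of f'] f' f'' that \<open>f' 0 = 0\<close>
    by (metis order_trans)
  then show ?thesis
    using DERIV_nonneg_imp_nondecreasing[of 0 1 f] f \<open>f 0 = 0\<close>
    by (metis zero_le_one)
qed

text \<open>The right-hand side is the sum over the pairs \<open>{i, j}\<close> of \<open>m\<^sub>i + m\<^sub>j\<close> times the relative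
  entropy of \<open>m\<close> with respect to \<open>l\<close>, both conditioned on \<open>{i, j}\<close>. The difference of the two sides is
  convex in \<open>m\<close> with a critical zero at \<open>m = l\<close>.\<close>

lemma relative_entropy_le_pairs:
  fixes l m :: "real ^ 'r::finite"
  assumes l: "\<And>i. 0 < l $ i" "(\<Sum>i\<in>UNIV. l $ i) = 1"
    and m: "\<And>i. 0 < m $ i" "(\<Sum>i\<in>UNIV. m $ i) = 1"
  shows "(\<Sum>i\<in>UNIV. m $ i * (ln (m $ i) - ln (l $ i)))
    \<le> (\<Sum>i\<in>UNIV. m $ i * (ln (share_tuple m $ i) - ln (share_tuple l $ i)))"
proof -
  define e where "e i = m $ i - l $ i" for i
  define x where "x t i = l $ i + t * e i" for t i
  \<comment> \<open>Along the segment from \<open>l\<close> to \<open>m\<close>, \<open>f\<close>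
    below is right side minus left side of the claim; this \<open>c\<close> makes its value and
    slope vanish at \<open>t = 0\<close>.\<close>
  define c where "c i = ln (share_tuple l $ i) - ln (l $ i)" for i
  define f where "f t = (\<Sum>i\<in>UNIV. \<Sum>j\<in>UNIV - {i}. x t i * (ln (x t i) - ln (x t i + x t j)))
    - (\<Sum>i\<in>UNIV. x t i * (ln (x t i) + c i))" for t
  define f' where "f' t = (\<Sum>i\<in>UNIV. \<Sum>j\<in>UNIV - {i}. e i * (ln (x t i) - ln (x t i + x t j)))
    - (\<Sum>i\<in>UNIV. e i * (ln (x t i) + c i))" for t
  define f'' where "f'' t = (\<Sum>i\<in>UNIV. \<Sum>j\<in>UNIV - {i}. (e i)^2 / x t i - e i * (e i + e j) / (x t i + x t j))
    - (\<Sum>i\<in>UNIV. (e i)^2 / x t i)" for t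
  have e_sum: "(\<Sum>i\<in>UNIV. e i) = 0"
    using l m by (simp add: e_def sum_subtractf)
  have x_sum: "(\<Sum>i\<in>UNIV. x t i) = 1" for t
    using l e_sum by (simp add: x_def sum.distrib flip: sum_distrib_left)
  have x_pos: "0 < x t i" if "0 \<le> t" "t \<le> 1" for t i
  proof -
    have "x t i = (1 - t) * l $ i + t * m $ i" by (simp add: x_def e_def algebra_simps)
    moreover have "0 < (1 - t) * l $ i + t * m $ i"
      using that l(1)[of i] m(1)[of i]
      by (cases "t = 0") (auto intro!: add_nonneg_pos mult_nonneg_nonneg mult_pos_pos)
    ultimately show ?thesis by simp
  qed
  have x_deriv: "((\<lambda>t. x t i) has_real_derivative e i) (at t)" for t i
    unfolding x_def by (auto intro!: derivative_eq_intros)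
  have "0 \<le> f 1"
  proof (rule nonneg_of_second_derivative)
    fix t :: real assume t: "0 \<le> t" "t \<le> 1"
    note pos = x_pos[OF t]
    have pos2: "0 < x t i + x t j" for i j
      using pos[of i] pos[of j] by simp
    have "(f has_real_derivative
      (\<Sum>i\<in>UNIV. \<Sum>j\<in>UNIV - {i}. e i * (ln (x t i) - ln (x t i + x t j))
          + x t i * (e i / x t i - (e i + e j) / (x t i + x t j)))
      - (\<Sum>i\<in>UNIV. e i * (ln (x t i) + c i) + x t i * (e i / x t i))) (at t)"
      unfolding f_def using pos pos2
      by (auto intro!: derivative_eq_intros x_deriv sum.cong simp: less_imp_neq[THEN not_sym])
    also have "(\<Sum>i\<in>UNIV. e i * (ln (x t i) + c i) + x t i * (e i / x t i))
        = (\<Sum>i\<in>UNIV. e i * (ln (x t i) + c i))"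
      using pos e_sum by (simp add: sum.distrib less_imp_neq[THEN not_sym])
    also have "(\<Sum>i\<in>UNIV. \<Sum>j\<in>UNIV - {i}. e i * (ln (x t i) - ln (x t i + x t j))
          + x t i * (e i / x t i - (e i + e j) / (x t i + x t j)))
        = (\<Sum>i\<in>UNIV. \<Sum>j\<in>UNIV - {i}. e i * (ln (x t i) - ln (x t i + x t j)))"
    proof (rule sum_off_diagonal_cong)
      fix i j
      \<comment> \<open>The terms from differentiating the logarithms cancel between the two orders
        of a pair: they add up to \<open>a + b - (a + b)\<close>.\<close>
      have cancel: "p * (a / p - (a + b) / (p + q)) + q * (b / q - (a + b) / (p + q)) = 0"
        if "0 < p" "0 < q" for p q a b :: real
      proof -
        have "p * (a / p - (a + b) / (p + q)) + q * (b / q - (a + b) / (p + q))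
          = a + b - (p + q) * ((a + b) / (p + q))"
          using that by (simp add: right_diff_distrib distrib_right add_divide_distrib)
        then show ?thesis using that by simp
      qed
      have "x t i * (e i / x t i - (e i + e j) / (x t i + x t j))
          + x t j * (e j / x t j - (e j + e i) / (x t j + x t i)) = 0"
        using cancel[OF pos[of i] pos[of j], of "e i" "e j"] by (simp add: add.commute)
      then show "e i * (ln (x t i) - ln (x t i + x t j))
          + x t i * (e i / x t i - (e i + e j) / (x t i + x t j))
        + (e j * (ln (x t j) - ln (x t j + x t i))
          + x t j * (e j / x t j - (e j + e i) / (x t j + x t i)))
        = e i * (ln (x t i) - ln (x t i + x t j)) + e j * (ln (x t j) - ln (x t j + x t i))"
        by linarith
    qed
    finally show "(f has_real_derivative f' t) (at t)"
      unfolding f'_def .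
    show "(f' has_real_derivative f'' t) (at t)"
      unfolding f'_def f''_def using pos pos2
      by (auto intro!: derivative_eq_intros x_deriv sum.cong
          simp: less_imp_neq[THEN not_sym] power2_eq_square right_diff_distrib)
    show "0 \<le> f'' t"
      unfolding f''_def using hessian_nonneg[of "x t" e] pos x_sum e_sum by simp
  next
    have x0: "x 0 i = l $ i" for i by (simp add: x_def)
    show "f 0 = 0" "f' 0 = 0"
      unfolding f_def f'_def x0 c_def
      by (simp_all add: ln_share_tuple l flip: sum_distrib_left)
  qed
  moreover have x1: "x 1 i = m $ i" for i by (simp add: x_def e_def)
  ultimately have "(\<Sum>i\<in>UNIV. m $ i * (ln (m $ i) + c i)) \<le> (\<Sum>i\<in>UNIV. m $ i * ln (share_tuple m $ i))"
    unfolding f_def x1 by (simp add: ln_share_tuple m flip: sum_distrib_left)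
  then show ?thesis
    by (simp add: c_def algebra_simps sum.distrib sum_subtractf)
qed

text \<open>Apply \<open>ln t <= t - 1\<close> at \<open>t = l $ i * R / m $ i\<close>, with
  \<open>R\<close> the quotient of the share tuples at \<open>i\<close>, and average with weights
  \<open>m\<close>. By \<open>relative_entropy_le_pairs\<close> the resulting lower bound is at
  least 1.\<close>

lemma share_tuple_supporting_hyperplane:
  fixes l m :: "real ^ 'r::finite"
  assumes l: "\<And>i. 0 < l $ i" "(\<Sum>i\<in>UNIV. l $ i) = 1"
    and m: "\<And>i. 0 < m $ i" "(\<Sum>i\<in>UNIV. m $ i) = 1"
  shows "1 \<le> (\<Sum>i\<in>UNIV. l $ i * (share_tuple m $ i / share_tuple l $ i))"
proof -
  have "m $ i * (1 + (ln (share_tuple m $ i) - ln (share_tuple l $ i)) - (ln (m $ i) - ln (l $ i)))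
    \<le> l $ i * (share_tuple m $ i / share_tuple l $ i)" for i
  proof -
    define R where "R = share_tuple m $ i / share_tuple l $ i"
    have pos: "0 < share_tuple m $ i" "0 < share_tuple l $ i" "0 < R"
      using share_tuple_pos[of l i] share_tuple_pos[of m i] l m by (auto simp: R_def)
    have "ln (l $ i * R / m $ i) \<le> l $ i * R / m $ i - 1"
      using pos l(1)[of i] m(1)[of i] by (intro ln_le_minus_one) simp
    moreover have "ln (l $ i * R / m $ i) = (ln (share_tuple m $ i) - ln (share_tuple l $ i)) - (ln (m $ i) - ln (l $ i))"
      using pos l(1)[of i] m(1)[of i] by (simp add: ln_mult ln_div R_def)
    ultimately have "m $ i * (1 + (ln (share_tuple m $ i) - ln (share_tuple l $ i)) - (ln (m $ i) - ln (l $ i)))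
      \<le> m $ i * (l $ i * R / m $ i)"
      using m(1)[of i] by (intro mult_left_mono) auto
    then show ?thesis
      using m(1)[of i] by (simp add: R_def)
  qed
  then have "(\<Sum>i\<in>UNIV. m $ i * (1 + (ln (share_tuple m $ i) - ln (share_tuple l $ i)) - (ln (m $ i) - ln (l $ i))))
    \<le> (\<Sum>i\<in>UNIV. l $ i * (share_tuple m $ i / share_tuple l $ i))"
    by (rule sum_mono)
  then show ?thesis
    using relative_entropy_le_pairs[OF l m] m
    by (simp add: algebra_simps sum.distrib sum_subtractf)
qed

section \<open>Every positive tuple is a multiple of a share tuple\<close>

lemma continuous_on_x_ln_x: "continuous_on {0..} (\<lambda>x::real. x * ln x)"
  unfolding continuous_on_def
proof
  fix x :: real assume "x \<in> {0..}"
  show "((\<lambda>x. x * ln x) \<longlongrightarrow> x * ln x) (at x within {0..})"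
  proof (cases "x = 0")
    case True
    have "((\<lambda>x::real. x * ln x) \<longlongrightarrow> 0) (at_right 0)" by real_asymp
    then show ?thesis using True by (simp add: at_within_Ici_at_right)
  next
    case False
    then show ?thesis by (intro tendsto_intros) auto
  qed
qed

text \<open>Continuity must reach the boundary: the maximum is taken over the closed simplex before
  its maximiser is known to be interior.\<close>

lemma continuous_on_share_entropy:
  "continuous_on {l. \<forall>i. 0 \<le> l $ i} (share_entropy :: real ^ 'r::finite \<Rightarrow> real)"
proof -
  have comp: "continuous_on {l :: real ^ 'r. \<forall>i. 0 \<le> l $ i} (\<lambda>l. f l * ln (f l))"
    if "continuous_on {l. \<forall>i. 0 \<le> l $ i} f" "\<And>l. \<forall>i. 0 \<le> l $ i \<Longrightarrow> 0 \<le> f l" for f :: "real ^ 'r \<Rightarrow> real"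
    by (rule continuous_on_compose2[OF continuous_on_x_ln_x that(1)]) (use that(2) in auto)
  show ?thesis
    unfolding share_entropy_def
    by (intro continuous_intros comp) auto
qed

lemma compact_simplex: "compact {l :: real ^ 'r::finite. (\<forall>i. 0 \<le> l $ i) \<and> (\<Sum>i\<in>UNIV. l $ i) = 1}"
  (is "compact ?S")
proof -
  have "l $ i \<le> 1" if "l \<in> ?S" for l i
    using member_le_sum[of i UNIV "\<lambda>i. l $ i"] that by simp
  then have "?S \<subseteq> cbox 0 1"
    by (auto simp: mem_box_cart)
  moreover have "closed ?S"
    by (intro closed_Collect_conj closed_Collect_all closed_Collect_le closed_Collect_eq continuous_intros)
  ultimately show ?thesis
    using bounded_subset[OF bounded_cbox] by (auto simp: compact_eq_bounded_closed)
qed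

text \<open>All other factors are at most 1. The bound makes entry \<open>i\<close> small when
  \<open>l $ i\<close> is small relative to \<open>l $ k\<close>.\<close>

lemma share_tuple_le:
  assumes "\<And>i. 0 < l $ i" and "i \<noteq> k"
  shows "share_tuple l $ i \<le> l $ i / (l $ i + l $ k)"
proof -
  have quot: "0 \<le> l $ i / (l $ i + l $ j) \<and> l $ i / (l $ i + l $ j) \<le> 1" for j
    using assms(1)[of i] assms(1)[of j] by simp
  have "share_tuple l $ i = l $ i / (l $ i + l $ k) * (\<Prod>j\<in>UNIV - {i} - {k}. l $ i / (l $ i + l $ j))"
    unfolding share_tuple_def generated_tuple_def using assms(2) by (simp add: prod.remove[of _ k])
  also have "\<dots> \<le> l $ i / (l $ i + l $ k)"
    using quot by (intro mult_left_le prod_le_1) auto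
  finally show ?thesis .
qed

lemma share_tuple_le_1:
  assumes "\<And>i. 0 < l $ i"
  shows "share_tuple l $ i \<le> 1"
  unfolding share_tuple_def generated_tuple_def
  using assms by (auto intro!: prod_le_1 simp: less_imp_le add_pos_pos)

lemma share_tuple_scale: "k \<noteq> 0 \<Longrightarrow> share_tuple (k *\<^sub>R l) = share_tuple l"
  unfolding share_tuple_def by (simp flip: distrib_left)

text \<open>The entropic support function \<open>\<Sum>i. l\<^sub>i ln z\<^sub>i - share_entropy l\<close> of \<open>z\<close> is maximised
  over the simplex. Comparing the maximiser with perturbations towards the barycentre shows that it is
  interior, and with perturbations along the axes that all \<open>z\<^sub>i / (share_tuple l)\<^sub>i\<close> agree.\<close>

lemma ex_scaled_share_tuple:
  fixes z :: "real ^ 'r::finite"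
  assumes z: "\<And>i. 0 < z $ i"
  obtains l s where "\<And>i. 0 < l $ i" "(\<Sum>i\<in>UNIV. l $ i) = 1" "0 < s" "z = s *\<^sub>R share_tuple l"
proof -
  define S where "S = {l :: real ^ 'r. (\<forall>i. 0 \<le> l $ i) \<and> (\<Sum>i\<in>UNIV. l $ i) = 1}"
  define F where "F l = (\<Sum>i\<in>UNIV. l $ i * ln (z $ i)) - share_entropy l" for l
  have "continuous_on S F"
    unfolding F_def
    by (intro continuous_intros continuous_on_subset[OF continuous_on_share_entropy]) (auto simp: S_def)
  moreover have "axis undefined 1 \<in> S"
    by (auto simp: S_def axis_def)
  ultimately obtain l where l: "l \<in> S" and max: "\<And>m. m \<in> S \<Longrightarrow> F m \<le> F l"
    using continuous_attains_sup[of S F] compact_simplex unfolding S_def by blast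
  have l_nonneg: "0 \<le> l $ i" for i using l by (simp add: S_def)
  have l_sum: "(\<Sum>i\<in>UNIV. l $ i) = 1" using l by (simp add: S_def)
  define h where "h m i = ln (z $ i) - F l - ln (share_tuple m $ i)" for m i
  \<comment> \<open>Maximality at the normalised \<open>m\<close> bounds the
    \<open>m\<close>-weighted sum above by \<open>F l * M\<close>; Gibbs bounds the
    \<open>l\<close>-weighted sum below by \<open>F l\<close>. Subtracting gives a variational
    inequality for unnormalised \<open>m\<close>.\<close>
  have key: "(\<Sum>i\<in>UNIV. (m $ i - l $ i) * h m i) \<le> 0" if m: "\<And>i. 0 < m $ i" for m
  proof -
    define M where "M = (\<Sum>i\<in>UNIV. m $ i)"
    have M: "0 < M" unfolding M_def using m by (intro sum_pos) auto
    define n where "n = inverse M *\<^sub>R m"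
    have n_pos: "0 < n $ i" for i using m M by (simp add: n_def)
    have "(\<Sum>i\<in>UNIV. n $ i) = 1"
      using M by (simp add: n_def M_def flip: sum_distrib_left)
    then have "F n \<le> F l"
      using n_pos by (intro max) (auto simp: S_def less_imp_le)
    moreover have "F n = (\<Sum>i\<in>UNIV. m $ i * (ln (z $ i) - ln (share_tuple m $ i))) / M"
    proof -
      have "F n = (\<Sum>i\<in>UNIV. n $ i * (ln (z $ i) - ln (share_tuple n $ i)))"
        unfolding F_def share_entropy_eq[OF n_pos] by (simp add: right_diff_distrib sum_subtractf)
      also have "share_tuple n = share_tuple m"
        unfolding n_def using M by (intro share_tuple_scale) simp
      finally show ?thesis
        by (simp add: n_def sum_distrib_left divide_inverse mult_ac)
    qed
    ultimately have "(\<Sum>i\<in>UNIV. m $ i * (ln (z $ i) - ln (share_tuple m $ i))) \<le> F l * M"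
      using M by (simp add: divide_le_eq)
    moreover have "F l \<le> (\<Sum>i\<in>UNIV. l $ i * (ln (z $ i) - ln (share_tuple m $ i)))"
      using gibbs_share_tuple[of m l] m l_nonneg by (simp add: F_def right_diff_distrib sum_subtractf)
    moreover have "(\<Sum>i\<in>UNIV. (m $ i - l $ i) * h m i)
      = (\<Sum>i\<in>UNIV. m $ i * (ln (z $ i) - ln (share_tuple m $ i)))
        - (\<Sum>i\<in>UNIV. l $ i * (ln (z $ i) - ln (share_tuple m $ i))) - F l * M + F l * (\<Sum>i\<in>UNIV. l $ i)"
      unfolding h_def M_def sum_distrib_left
      by (simp add: algebra_simps flip: sum_subtractf sum.distrib)
    ultimately show ?thesis
      by (simp add: l_sum)
  qed
  have l_pos: "0 < l $ i" for i
  proof (rule ccontr)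
    assume "\<not> 0 < l $ i"
    then have li: "l $ i = 0" using l_nonneg[of i] by simp
    obtain k where k: "0 < l $ k"
      using l_sum l_nonneg by (metis less_eq_real_def sum.neutral zero_neq_one)
    then have "k \<noteq> i" using li by auto
    define K where "K = (\<Sum>j\<in>UNIV. ln (z $ j) - F l)"
    \<comment> \<open>With \<open>d\<close> added to every coordinate of \<open>l\<close>,
      \<open>key\<close> gives \<open>exp K <= m $ i / (m $ i + m $ k) <= d / l $ k\<close>; this
      \<open>d\<close> makes the last quotient \<open>exp K / 2\<close>, a contradiction.\<close>
    define d where "d = l $ k * exp K / 2"
    have d: "0 < d" using k by (simp add: d_def)
    define m where "m = (\<chi> j. l $ j + d)"
    have m: "0 < m $ j" for j using l_nonneg[of j] d by (simp add: m_def)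
    have "d * (\<Sum>j\<in>UNIV. h m j) \<le> 0"
      using key[OF m] by (simp add: m_def sum_distrib_left)
    then have "(\<Sum>j\<in>UNIV. h m j) \<le> 0"
      using d by (simp add: mult_le_0_iff)
    then have "K \<le> (\<Sum>j\<in>UNIV. ln (share_tuple m $ j))"
      by (simp add: h_def K_def sum_subtractf)
    also have "\<dots> \<le> (\<Sum>j\<in>{i}. ln (share_tuple m $ j))"
    proof -
      have "ln (share_tuple m $ j) \<le> 0" for j
        using share_tuple_le_1[OF m, of j] share_tuple_pos[OF m, of j] by simp
      then show ?thesis
        using sum_mono2[of UNIV "{i}" "\<lambda>j. - ln (share_tuple m $ j)"] by (simp add: sum_negf)
    qed
    also have "\<dots> \<le> ln (m $ i / (m $ i + m $ k))"
      using share_tuple_le[OF m \<open>k \<noteq> i\<close>[symmetric]] share_tuple_pos[OF m, of i] by (simp add: ln_mono)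
    finally have "exp K \<le> m $ i / (m $ i + m $ k)"
      using m[of i] m[of k] by (simp add: ln_ge_iff)
    also have "\<dots> \<le> d / l $ k"
      using d k by (auto simp: m_def li intro!: divide_left_mono)
    also have "\<dots> = exp K / 2"
      using k by (simp add: d_def)
    finally show False by simp
  qed
  have h_zero: "h l i = 0" for i
  proof -
    \<comment> \<open>Moving only coordinate \<open>i\<close> by \<open>t\<close> turns
      \<open>key\<close> into \<open>t * g t <= 0\<close>, so by continuity the two one-sided signs
      force \<open>g 0 = 0\<close>.\<close>
    define g where "g t = h (l + axis i t) i" for t
    have near: "\<forall>\<^sub>F t in at 0. \<bar>t\<bar> < l $ i"
      unfolding eventually_at using l_pos[of i] by (intro exI[of _ "l $ i"]) auto
    have sign: "t * g t \<le> 0" if "\<bar>t\<bar> < l $ i" for t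
    proof -
      have m: "0 < (l + axis i t) $ j" for j
        using that l_pos[of j] by (auto simp: axis_def)
      have "(\<Sum>j\<in>UNIV. ((l + axis i t) $ j - l $ j) * h (l + axis i t) j)
        = (\<Sum>j\<in>UNIV. if j = i then t * g t else 0)"
        by (intro sum.cong) (auto simp: g_def axis_def)
      then show ?thesis using key[OF m] by simp
    qed
    have g_right: "g t \<le> 0" if "0 < t" "\<bar>t\<bar> < l $ i" for t
      using sign[OF that(2)] that(1) by (simp add: mult_le_0_iff)
    have g_left: "0 \<le> g t" if "t < 0" "\<bar>t\<bar> < l $ i" for t
      using sign[OF that(2)] that(1) by (simp add: mult_le_0_iff)
    have "isCont g 0"
    proof -
      have nz: "l $ i \<noteq> 0" "l $ i + l $ j \<noteq> 0" for j
        using l_pos[of i] l_pos[of j] by auto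
      have "share_tuple l $ i \<noteq> 0" using share_tuple_pos[OF l_pos, of i] by simp
      then show ?thesis
        unfolding g_def h_def share_tuple_def generated_tuple_def axis_def
        using nz by (auto intro!: continuous_intros simp: axis_def)
    qed
    then have lim: "(g \<longlongrightarrow> g 0) (at 0)" by (simp add: isCont_def)
    have "g 0 \<le> 0"
    proof (rule tendsto_upperbound[of g _ "at_right 0"])
      show "(g \<longlongrightarrow> g 0) (at_right 0)" using lim by (rule filterlim_mono) (auto simp: at_le)
      have "\<forall>\<^sub>F t in at_right 0. \<bar>t\<bar> < l $ i"
        using near at_le[of "{0<..}" UNIV "0::real"] by (auto simp: filter_leD)
      then show "\<forall>\<^sub>F t in at_right 0. g t \<le> 0"
        using eventually_at_right_less[of "0::real"]
        by eventually_elim (rule g_right)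
    qed simp
    moreover have "0 \<le> g 0"
    proof (rule tendsto_lowerbound[of g _ "at_left 0"])
      show "(g \<longlongrightarrow> g 0) (at_left 0)" using lim by (rule filterlim_mono) (auto simp: at_le)
      have "\<forall>\<^sub>F t in at_left 0. \<bar>t\<bar> < l $ i"
        using near at_le[of "{..<0}" UNIV "0::real"] by (auto simp: filter_leD)
      moreover have "\<forall>\<^sub>F t in at_left 0. t < (0::real)"
        by (simp add: eventually_at_filter)
      ultimately show "\<forall>\<^sub>F t in at_left 0. 0 \<le> g t"
        by eventually_elim (rule g_left)
    qed simp
    moreover have "l + axis i 0 = l" by (simp add: vec_eq_iff axis_def)
    ultimately show ?thesis by (simp add: g_def)
  qed
  have "z = exp (F l) *\<^sub>R share_tuple l"
  proof (subst vec_eq_iff, intro allI)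
    fix i
    have "0 < share_tuple l $ i" using share_tuple_pos[OF l_pos] .
    then have "ln (z $ i) = ln (exp (F l) * share_tuple l $ i)"
      using h_zero[of i] by (simp add: h_def ln_mult)
    then show "z $ i = (exp (F l) *\<^sub>R share_tuple l) $ i"
      using z[of i] \<open>0 < share_tuple l $ i\<close> by simp
  qed
  with l_pos l_sum show ?thesis
    by (intro that[of l "exp (F l)"]) auto
qed

section \<open>Convexity for positive tuples\<close>

lemma not_representable_convex_combination_pos:
  fixes x y :: "real ^ 'r::finite"
  assumes card: "CARD('r) \<ge> 2"
    and x: "\<And>i. 0 < x $ i" "\<not> representable x"
    and y: "\<And>i. 0 < y $ i" "\<not> representable y"
    and uv: "0 \<le> u" "0 \<le> v" "u + v = 1"
  shows "\<not> representable (u *\<^sub>R x + v *\<^sub>R y)"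
proof
  assume rep: "representable (u *\<^sub>R x + v *\<^sub>R y)"
  have large: "1 < s" if m: "\<And>i. 0 < m $ i" and s: "0 < s" "\<not> representable (s *\<^sub>R share_tuple m)"
    for m :: "real ^ 'r" and s
  proof (rule ccontr)
    assume "\<not> 1 < s"
    then have "representable (s *\<^sub>R share_tuple m)"
      using s(1) share_tuple_pos[OF m]
      by (intro representable_mono[OF card representable_share_tuple[OF m]])
        (auto simp: less_imp_le mult_left_le_one_le)
    with s(2) show False by simp
  qed
  obtain m s where m: "\<And>i. 0 < m $ i" "(\<Sum>i\<in>UNIV. m $ i) = 1" "0 < s" "x = s *\<^sub>R share_tuple m"
    using ex_scaled_share_tuple[of x] x(1) by metis
  obtain n t where n: "\<And>i. 0 < n $ i" "(\<Sum>i\<in>UNIV. n $ i) = 1" "0 < t" "y = t *\<^sub>R share_tuple n"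
    using ex_scaled_share_tuple[of y] y(1) by metis
  have "0 < (u *\<^sub>R x + v *\<^sub>R y) $ i" for i
    using uv x(1)[of i] y(1)[of i]
    by (cases "u = 0") (auto intro!: add_pos_nonneg mult_nonneg_nonneg mult_pos_pos simp: less_imp_le)
  then obtain l w where l: "\<And>i. 0 < l $ i" "(\<Sum>i\<in>UNIV. l $ i) = 1" "0 < w"
      "u *\<^sub>R x + v *\<^sub>R y = w *\<^sub>R share_tuple l"
    using ex_scaled_share_tuple[of "u *\<^sub>R x + v *\<^sub>R y"] by metis
  \<comment> \<open>\<open>L\<close> is 1 at \<open>share_tuple l\<close>, so it reads off the scale
    \<open>w\<close> of the combination; it is at least 1 at \<open>share_tuple m\<close> and
    \<open>share_tuple n\<close>.\<close>
  define L where "L p = (\<Sum>i\<in>UNIV. l $ i * (p $ i / share_tuple l $ i))" for p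
  have L_add: "L (a *\<^sub>R p + b *\<^sub>R q) = a * L p + b * L q" for a b p q
    by (simp add: L_def sum_distrib_left flip: sum.distrib)
      (simp add: distrib_left add_divide_distrib mult_ac)
  have L_scale: "L (a *\<^sub>R p) = a * L p" for a p
    using L_add[of a p 0 p] by simp
  have "L (share_tuple l) = 1"
    using share_tuple_pos[OF l(1)] l(2) by (simp add: L_def less_imp_neq[THEN not_sym])
  then have "w = u * L x + v * L y"
    using l(4) L_scale[of w "share_tuple l"] L_add[of u x v y] by simp
  moreover have "1 < L x"
  proof -
    have "1 < s" using large m x(2) by auto
    moreover have "1 \<le> L (share_tuple m)"
      unfolding L_def by (rule share_tuple_supporting_hyperplane[OF l(1,2) m(1,2)])
    ultimately show ?thesis
      unfolding m(4) L_scale using mult_left_mono[of 1 "L (share_tuple m)" s] by linarith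
  qed
  moreover have "1 < L y"
  proof -
    have "1 < t" using large n y(2) by auto
    moreover have "1 \<le> L (share_tuple n)"
      unfolding L_def by (rule share_tuple_supporting_hyperplane[OF l(1,2) n(1,2)])
    ultimately show ?thesis
      unfolding n(4) L_scale using mult_left_mono[of 1 "L (share_tuple n)" t] by linarith
  qed
  ultimately have "1 < w"
    using convex_bound_lt[of "- L x" "- 1" "- L y" u v] uv by simp
  moreover have "w \<le> 1"
    using representable_scaled_share_tuple[OF l(1) l(3)] rep l(4) by simp
  ultimately show False by simp
qed

section \<open>Reduction of tuples with zeros to positive tuples\<close>

text \<open>Expanding the right side gives both products plus nonnegative mixed terms. For empty
  \<open>A\<close> it would read \<open>2 <= 1\<close>.\<close>

lemma prod_add_ge:
  fixes f g :: "'a \<Rightarrow> real"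
  assumes "finite A" "A \<noteq> {}" "\<And>i. i \<in> A \<Longrightarrow> 0 \<le> f i" "\<And>i. i \<in> A \<Longrightarrow> 0 \<le> g i"
  shows "prod f A + prod g A \<le> (\<Prod>i\<in>A. f i + g i)"
  using assms
proof (induction rule: finite_ne_induct)
  case (insert i A)
  have "prod f (insert i A) + prod g (insert i A) \<le> (f i + g i) * (prod f A + prod g A)"
    using insert by (auto simp: algebra_simps intro!: mult_nonneg_nonneg prod_nonneg add_nonneg_nonneg)
  also have "\<dots> \<le> (f i + g i) * (\<Prod>i\<in>A. f i + g i)"
    using insert by (intro mult_left_mono) auto
  finally show ?case using insert by simp
qed simp

text \<open>The tuple bound obtained from mixing a generator with the constant generator \<open>1/2\<close> with weight \<open>e\<close>. It is
  affine in \<open>x\<close> and positive, which reduces the theorem to tuples without zeros.\<close>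

definition lifted :: "real \<Rightarrow> real ^ 'r::finite \<Rightarrow> real ^ 'r" where
  "lifted e x = (\<chi> i. (1 - e) ^ (CARD('r) - 1) * x $ i + (e / 2) ^ (CARD('r) - 1))"

text \<open>By \<open>prod_add_ge\<close>, applied to the factors of each row, the tuple of the
  mixed generator \<open>b\<close> dominates \<open>lifted e x\<close>; downward closure
  finishes.\<close>

lemma representable_lifted:
  fixes x :: "real ^ 'r::finite"
  assumes card: "CARD('r) \<ge> 2" and rep: "representable x" and e: "0 \<le> e" "e \<le> 1"
  shows "representable (lifted e x)"
proof -
  obtain a where a: "generator a" "generated_tuple a = x" and x: "\<And>i. 0 \<le> x $ i"
    using rep by (auto simp: representable_def)
  define b where "b i j = (1 - e) * a i j + e / 2" for i j
  have gen: "generator b"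
    unfolding generator_def
  proof (intro allI impI conjI)
    fix i j :: 'r assume "i \<noteq> j"
    then have aij: "0 \<le> a i j" "a i j \<le> 1" "a i j + a j i \<le> 1"
      using a(1) by (auto simp: generator_def)
    show "0 \<le> b i j" using aij e by (simp add: b_def)
    show "b i j \<le> 1"
      using mult_left_mono[OF aij(2), of "1 - e"] e by (simp add: b_def)
    show "b i j + b j i \<le> 1"
      using mult_left_mono[OF aij(3), of "1 - e"] e by (simp add: b_def algebra_simps)
  qed
  have lifted_le: "lifted e x $ i \<le> generated_tuple b $ i" for i
  proof -
    have "card (UNIV - {i}) = CARD('r) - 1" by simp
    moreover from this have "UNIV - {i} \<noteq> {}" using card by force
    moreover have "(\<Prod>j\<in>UNIV - {i}. a i j) = x $ i"
      using a(2) by (auto simp: generated_tuple_def)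
    ultimately show ?thesis
      using prod_add_ge[of "UNIV - {i}" "\<lambda>j. (1 - e) * a i j" "\<lambda>j. e / 2"] e a(1)
      by (simp add: lifted_def generated_tuple_def b_def prod.distrib generator_def)
  qed
  have lifted_nonneg: "0 \<le> lifted e x $ i" for i
    using x e by (simp add: lifted_def)
  have "representable (generated_tuple b)"
    using gen lifted_nonneg lifted_le by (force simp: representable_def intro: order_trans)
  then show ?thesis
    using lifted_nonneg lifted_le by (rule representable_mono[OF card])
qed

lemma closed_S_rep: "closed (S_rep :: (real ^ 'r::finite) set)"
proof -
  \<comment> \<open>Bounding the diagonal too makes \<open>G\<close> compact without changing which
    tuples are generated.\<close>
  define G where "G = {A :: real ^ 'r ^ 'r. \<forall>i j. 0 \<le> A $ i $ j \<and> A $ i $ j \<le> 1 \<and> (i \<noteq> j \<longrightarrow> A $ i $ j + A $ j $ i \<le> 1)}"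
  have "closed G"
    unfolding G_def
    by (intro closed_Collect_conj closed_Collect_all closed_Collect_le closed_Collect_imp open_Collect_const continuous_intros)
  moreover have "bounded G"
  proof (rule boundedI)
    fix A assume A: "A \<in> G"
    have "norm A \<le> (\<Sum>i\<in>UNIV. norm (A $ i))"
      by (simp add: norm_vec_def L2_set_le_sum)
    also have "\<dots> \<le> (\<Sum>i\<in>UNIV. \<Sum>j\<in>UNIV. \<bar>A $ i $ j\<bar>)"
      by (intro sum_mono norm_le_l1_cart)
    also have "\<dots> \<le> (\<Sum>i\<in>(UNIV :: 'r set). \<Sum>j\<in>(UNIV :: 'r set). 1)"
      using A by (intro sum_mono) (auto simp: G_def)
    finally show "norm A \<le> (\<Sum>i\<in>(UNIV :: 'r set). \<Sum>j\<in>(UNIV :: 'r set). 1)" .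
  qed
  ultimately have "compact G" by (simp add: compact_eq_bounded_closed)
  moreover have "continuous_on G (\<lambda>A. generated_tuple (\<lambda>i j. A $ i $ j))"
    unfolding generated_tuple_def by (intro continuous_intros)
  moreover have "S_rep = (\<lambda>A. generated_tuple (\<lambda>i j. A $ i $ j)) ` G"
  proof (intro equalityI subsetI)
    fix x :: "real ^ 'r" assume "x \<in> S_rep"
    then obtain a where a: "generator a" "generated_tuple a = x"
      by (auto simp: S_rep_def representable_def)
    define A where "A = (\<chi> i j. if i = j then 0 else a i j)"
    have "A \<in> G" using a(1) by (auto simp: A_def G_def generator_def)
    moreover have "generated_tuple (\<lambda>i j. A $ i $ j) = x"
      using a(2) by (auto simp: generated_tuple_def A_def intro!: prod.cong)
    ultimately show "x \<in> (\<lambda>A. generated_tuple (\<lambda>i j. A $ i $ j)) ` G" by blast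
  next
    fix x assume "x \<in> (\<lambda>A. generated_tuple (\<lambda>i j. A $ i $ j)) ` G"
    then obtain A where A: "A \<in> G" "x = generated_tuple (\<lambda>i j. A $ i $ j)" by blast
    then have "generator (\<lambda>i j. A $ i $ j)" "\<forall>i. 0 \<le> x $ i"
      by (auto simp: G_def generator_def generated_tuple_def prod_nonneg)
    then show "x \<in> S_rep"
      using A(2) by (auto simp: S_rep_def representable_def)
  qed
  ultimately show ?thesis
    using compact_continuous_image compact_imp_closed by metis
qed

text \<open>\<open>lifted e x\<close> tends to \<open>lifted 0 x\<close>, which is \<open>x\<close>
  because the exponent \<open>CARD('r) - 1\<close> is positive, and the complement of
  \<open>S_rep\<close> is open.\<close>

lemma eventually_not_representable_lifted:
  fixes x :: "real ^ 'r::finite"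
  assumes "CARD('r) \<ge> 2" "\<not> representable x"
  shows "\<forall>\<^sub>F e in at_right 0. \<not> representable (lifted e x)"
proof -
  have "((\<lambda>e. lifted e x) \<longlongrightarrow> lifted 0 x) (at_right 0)"
    unfolding lifted_def by (intro tendsto_intros) auto
  moreover have "lifted 0 x = x"
    using assms(1) by (simp add: lifted_def vec_eq_iff)
  moreover have "open (- S_rep :: (real ^ 'r) set)"
    using closed_S_rep by (rule open_Compl)
  ultimately have "\<forall>\<^sub>F e in at_right 0. lifted e x \<in> - S_rep"
    using assms(2) by (intro topological_tendstoD) (auto simp: S_rep_def)
  then show ?thesis by (simp add: S_rep_def)
qed

theorem mainTheorem2:
  assumes "CARD('r::finite) \<ge> 2"
  shows "convex (S_non :: (real ^ 'r) set)"
proof (rule convexI)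
  fix x y :: "real ^ 'r" and u v :: real
  assume x: "x \<in> S_non" and y: "y \<in> S_non" and uv: "0 \<le> u" "0 \<le> v" "u + v = 1"
  let ?z = "u *\<^sub>R x + v *\<^sub>R y"
  have "\<forall>\<^sub>F e in at_right 0. \<not> representable (lifted e x)"
    "\<forall>\<^sub>F e in at_right 0. \<not> representable (lifted e y)"
    using x y assms by (auto intro!: eventually_not_representable_lifted simp: S_non_def S_rep_def)
  moreover have "\<forall>\<^sub>F e in at_right 0. e \<in> {0<..<1::real}"
    by (rule eventually_at_right_real) simp
  ultimately have "\<forall>\<^sub>F e in at_right (0::real). \<not> representable (lifted e x) \<and>
      \<not> representable (lifted e y) \<and> e \<in> {0<..<1}"
    by eventually_elim simp
  then obtain e where e: "\<not> representable (lifted e x)" "\<not> representable (lifted e y)" "0 < e" "e < 1"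
    using eventually_happens'[OF trivial_limit_at_right_real] by fastforce
  have pos: "0 < lifted e w $ i" if "w \<in> S_non" for w :: "real ^ 'r" and i
    using that e by (auto simp: lifted_def S_non_def intro!: add_nonneg_pos)
  have "lifted e ?z = u *\<^sub>R lifted e x + v *\<^sub>R lifted e y"
  proof -
    \<comment> \<open>The constant term is preserved because \<open>u + v = 1\<close>.\<close>
    define c where "c = (e / 2) ^ (CARD('r) - 1)"
    have "c = u * c + v * c" using uv by (simp flip: distrib_right)
    then show ?thesis
      unfolding lifted_def c_def[symmetric] by (simp add: vec_eq_iff algebra_simps)
  qed
  then have "\<not> representable (lifted e ?z)"
    using not_representable_convex_combination_pos[OF assms] pos x y e uv by simp
  \<comment> \<open>Lifting preserves representability, so non-representability passes back from the
    lift to \<open>?z\<close>.\<close>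
  then have "\<not> representable ?z"
    using representable_lifted[OF assms] e by (auto simp: less_imp_le)
  moreover have "0 \<le> ?z $ i \<and> ?z $ i \<le> 1" for i
    using x y uv convex_bound_le[of "x $ i" 1 "y $ i" u v] by (auto simp: S_non_def)
  ultimately show "?z \<in> S_non"
    by (auto simp: S_non_def S_rep_def)
qed

end
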